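(* For integers $r,m\ge0$, $$\mathcal{Q}_{r,m}^{t,s}(X)=\sum_{k=0}^{m}f_k(t,s)\,q_{r+k}(X;t)\,q_{m-k}(X;s).$$ For $s=t$, this becomes $$\mathcal{Q}_{r,m}^{t,t}(X)=q_r(X;t)q_m(X;t)+2\sum_{k=1}^{m}(-1)^k q_{r+k}(X;t)\,q_{m-k}(X;t).$$
   Context: Let $t,s$ be indeterminates, $\mathbb{K}=\mathbb{Q}(t,s)$, and let operators act on $\Gamma_{\mathbb{K}}=\mathbb{K}[p_1,p_3,p_5,\ldots]$ (with $p_n=p_n(X)$ the odd power sums of an alphabet $X$), with unit element $\mathbf{1}$. For odd $n\ge1$, $a_{-n}$ is multiplication by $p_n$ and $a_n=\frac n2\frac{\partial}{\partial p_n}$. The modified operator is $$\mathcal{Y}(z;t)=\exp\Big(\sum_{n\ge1,\ n\text{ odd}}\tfrac{2(1-t^n)}n a_{-n}z^n\Big)\exp\Big(-\sum_{n\ge1,\ n\text{ odd}}\tfrac2{n(1-t^n)} a_nz^{-n}\Big)=\sum_{m\in\mathbb{Z}}\mathcal{Y}_m(t)z^{-m},$$ and $\mathcal{Y}(w;s)$ is defined in the same way with $(z,t)$ replaced by $(w,s)$. The modified one-row functions are defined by $$\mathcal{Y}(z;t)\mathbf{1}=\exp\Big(2\sum_{n\ge1,\ n\text{ odd}}\tfrac{1-t^n}{n}p_n(X)z^n\Big)=\sum_{r\ge0}q_r(X;t)z^r,$$ so $q_r(X;t)=\mathcal{Y}_{-r}(t)\mathbf{1}$. The mixed two-row coefficient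 is $$\mathcal{Q}_{r,m}^{t,s}(X)=[z^rw^m]\,\mathcal{Y}(z;t)\mathcal{Y}(w;s)\mathbf{1}=\mathcal{Y}_{-r}(t)\mathcal{Y}_{-m}(s)\mathbf{1}.$$ The coefficients $f_k(t,s)$ are defined by $$\exp\Big(-2\sum_{n\ge1,\ n\text{ odd}}\frac{1-s^n}{1-t^n}\frac{u^n}{n}\Big)=\sum_{k\ge0}f_k(t,s)u^k.$$ For $s=t$ the same definitions are used with both parameters equal to $t$, over $\mathbb{Q}(t)$. *)

theory Defs
  imports
    "HOL-Library.Poly_Mapping"
    "HOL-Computational_Algebra.Polynomial"
    "HOL-Computational_Algebra.Fraction_Field"
    "HOL-Computational_Algebra.Formal_Power_Series"
begin

subsection \<open>The fields Q(t,s) and Q(t)\<close>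

instance fract :: ("{idom, ring_char_0}") field_char_0
proof
  show "inj (of_nat :: nat \<Rightarrow> 'a fract)"
    by (rule injI) (simp add: of_nat_fract eq_fract)
qed

text \<open>Q(t,s) is the field of fractions of Q[t][s]: the inner indeterminate is t, the outer one is s.\<close>

type_synonym rat_ts = "rat poly poly fract"

definition t_var :: rat_ts where "t_var = Fract [:[:0, 1:]:] 1"

definition s_var :: rat_ts where "s_var = Fract [:0, 1:] 1"

type_synonym rat_t = "rat poly fract"

definition t_var1 :: rat_t where "t_var1 = Fract [:0, 1:] 1"

subsection \<open>The polynomial ring in the odd power sums\<close>

text \<open>
  The ring K[p_1, p_3, p_5, ...]. The polynomial variable with index i stands for p_(2i+1),
  so for odd n the power sum p_n is the variable with index n div 2.
  Power products are finitely supported exponent functions.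
\<close>

type_synonym 'k gam = "(nat \<Rightarrow>\<^sub>0 nat) \<Rightarrow>\<^sub>0 'k"

definition gscale :: "'k::comm_ring_1 \<Rightarrow> 'k gam \<Rightarrow> 'k gam" where
  "gscale c f = Poly_Mapping.single 0 c * f"

definition psum :: "nat \<Rightarrow> 'k::comm_ring_1 gam" where
  "psum n = Poly_Mapping.single (Poly_Mapping.single (n div 2) 1) 1"

text \<open>
  Partial derivative. If variable i does not occur in e, the truncated subtraction is harmless
  because the coefficient is 0.
\<close>

definition pdiff_var :: "nat \<Rightarrow> 'k::comm_ring_1 gam \<Rightarrow> 'k gam" where
  "pdiff_var i f = (\<Sum>e\<in>Poly_Mapping.keys f.
     Poly_Mapping.single (e - Poly_Mapping.single i 1)
       (of_nat (Poly_Mapping.lookup e i) * Poly_Mapping.lookup f e))"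

text \<open>The operators a_n for odd integers n; the values at even n are never used.\<close>

definition heis :: "int \<Rightarrow> 'k::field_char_0 gam \<Rightarrow> 'k gam" where
  "heis n f = (if n < 0 then psum (nat (- n)) * f
               else gscale (of_int n / 2) (pdiff_var (nat n div 2) f))"

subsection \<open>Formal series of operators\<close>

text \<open>
  A function A from naturals to operators represents the formal series with coefficients A n
  in one variable (z or its inverse); products of coefficients are compositions.
  The exponential is the series of powers of A divided by factorials. It is meant for series with
  A 0 = 0; then the k-th power has no term below degree k, so that cutting off at k = n is exact.
\<close>

primrec op_power :: "(nat \<Rightarrow> 'k::field_char_0 gam \<Rightarrow> 'k gam) \<Rightarrow> nat \<Rightarrow> nat \<Rightarrow> 'k gam \<Rightarrow> 'k gam" where
  "op_power A 0 = (\<lambda>n f. if n = 0 then f else 0)"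
| "op_power A (Suc k) = (\<lambda>n f. \<Sum>i\<le>n. A i (op_power A k (n - i) f))"

definition op_exp :: "(nat \<Rightarrow> 'k::field_char_0 gam \<Rightarrow> 'k gam) \<Rightarrow> nat \<Rightarrow> 'k gam \<Rightarrow> 'k gam" where
  "op_exp A n f = (\<Sum>k\<le>n. gscale (1 / fact k) (op_power A k n f))"

text \<open>The exponents of the two exponential factors, as series in z and in the inverse of z.\<close>

definition Y_create :: "'k::field_char_0 \<Rightarrow> nat \<Rightarrow> 'k gam \<Rightarrow> 'k gam" where
  "Y_create t n f = (if odd n then gscale (2 * (1 - t ^ n) / of_nat n) (heis (- int n) f) else 0)"

definition Y_annih :: "'k::field_char_0 \<Rightarrow> nat \<Rightarrow> 'k gam \<Rightarrow> 'k gam" where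
  "Y_annih t n f = (if odd n then gscale (- (2 / (of_nat n * (1 - t ^ n)))) (heis (int n) f) else 0)"

text \<open>
  The mode Y_m(t) is the coefficient of z^(-m): a term z^i of the first factor meets a term z^(-j) of
  the second one with i = j - m. On each polynomial only finitely many j contribute,
  see the lemma \<open>finite_annih\<close> below.
\<close>

definition Y_mode :: "'k::field_char_0 \<Rightarrow> int \<Rightarrow> 'k gam \<Rightarrow> 'k gam" where
  "Y_mode t m f = Sum_any (\<lambda>j. if m \<le> int j
     then op_exp (Y_create t) (nat (int j - m)) (op_exp (Y_annih t) j f) else 0)"

subsection \<open>One-row functions, mixed coefficients and the expansion coefficients\<close>

text \<open>Exponential of a power series over the polynomial ring without constant term.\<close>

definition gam_exp :: "'k::field_char_0 gam fps \<Rightarrow> 'k gam fps" where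
  "gam_exp A = Abs_fps (\<lambda>n. \<Sum>k\<le>n. gscale (1 / fact k) (fps_nth (A ^ k) n))"

definition q_exponent :: "'k::field_char_0 \<Rightarrow> 'k gam fps" where
  "q_exponent t = Abs_fps (\<lambda>n. if odd n then gscale (2 * (1 - t ^ n) / of_nat n) (psum n) else 0)"

definition q_row :: "'k::field_char_0 \<Rightarrow> nat \<Rightarrow> 'k gam" where
  "q_row t r = fps_nth (gam_exp (q_exponent t)) r"

definition Q_mixed :: "'k::field_char_0 \<Rightarrow> 'k \<Rightarrow> nat \<Rightarrow> nat \<Rightarrow> 'k gam" where
  "Q_mixed t s r m = Y_mode t (- int r) (Y_mode s (- int m) 1)"

definition f_coeff :: "'k::field_char_0 \<Rightarrow> 'k \<Rightarrow> nat \<Rightarrow> 'k" where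
  "f_coeff t s k = fps_nth (fps_exp 1 oo
     Abs_fps (\<lambda>n. if odd n then - 2 * ((1 - s ^ n) / (1 - t ^ n)) / of_nat n else 0)) k"

subsection \<open>Sanity checks for the definitions\<close>

text \<open>
  The sum defining \<open>Y_mode\<close> is finite: the annihilation part lowers the weighted degree, where p_n
  has weight n.
\<close>

definition weight :: "(nat \<Rightarrow>\<^sub>0 nat) \<Rightarrow> nat" where
  "weight e = (\<Sum>i\<in>Poly_Mapping.keys e. (2 * i + 1) * Poly_Mapping.lookup e i)"

definition weight_le :: "int \<Rightarrow> 'k::comm_ring_1 gam \<Rightarrow> bool" where
  "weight_le d f \<longleftrightarrow> (\<forall>e\<in>Poly_Mapping.keys f. int (weight e) \<le> d)"

lemma weight_minus_single:
  assumes "Poly_Mapping.lookup e i > 0"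
  shows "weight e = weight (e - Poly_Mapping.single i 1) + (2 * i + 1)"
proof -
  let ?e = "e - Poly_Mapping.single i 1"
  have l: "Poly_Mapping.lookup ?e j = (if j = i then Poly_Mapping.lookup e i - 1
      else Poly_Mapping.lookup e j)" for j
    by (simp add: lookup_minus lookup_single)
  have i: "i \<in> Poly_Mapping.keys e" using assms by (simp add: in_keys_iff)
  have sub: "Poly_Mapping.keys ?e \<subseteq> Poly_Mapping.keys e"
    using l i by (auto simp: in_keys_iff split: if_splits)
  have "weight ?e = (\<Sum>j\<in>Poly_Mapping.keys e. (2 * j + 1) * Poly_Mapping.lookup ?e j)"
    unfolding weight_def by (rule sum.mono_neutral_left) (use sub in \<open>auto simp: in_keys_iff\<close>)
  also have "\<dots> = (2 * i + 1) * (Poly_Mapping.lookup e i - 1) +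
      (\<Sum>j\<in>Poly_Mapping.keys e - {i}. (2 * j + 1) * Poly_Mapping.lookup e j)"
    by (subst sum.remove[OF _ i]) (auto simp: l[unfolded One_nat_def] intro!: sum.cong)
  finally have w: "weight ?e = \<dots>" .
  have "weight e = (2 * i + 1) * Poly_Mapping.lookup e i +
      (\<Sum>j\<in>Poly_Mapping.keys e - {i}. (2 * j + 1) * Poly_Mapping.lookup e j)"
    unfolding weight_def by (subst sum.remove[OF _ i]) auto
  moreover have "(2 * i + 1) * Poly_Mapping.lookup e i =
      (2 * i + 1) * (Poly_Mapping.lookup e i - 1) + (2 * i + 1)"
    using assms by (cases "Poly_Mapping.lookup e i") auto
  ultimately show ?thesis using w by simp
qed

lemma weight_le_0 [simp]: "weight_le d 0"
  by (simp add: weight_le_def)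

lemma weight_le_single: "int (weight e) \<le> d \<Longrightarrow> weight_le d (Poly_Mapping.single e c)"
  by (simp add: weight_le_def)

lemma weight_le_sum:
  assumes "\<And>x. x \<in> S \<Longrightarrow> weight_le d (g x)"
  shows "weight_le d (sum g S)"
  using assms
proof (induction S rule: infinite_finite_induct)
  case (insert x F)
  have "weight_le d (g x)" "weight_le d (sum g F)" using insert by auto
  then show ?case using insert(1,2) keys_add[of "g x" "sum g F"]
    by (auto simp: weight_le_def)
qed auto

lemma lookup_gscale: "Poly_Mapping.lookup (gscale c f) e = c * Poly_Mapping.lookup f e"
proof -
  have "gscale c f = Poly_Mapping.map ((*) c) f"
    by (simp add: gscale_def mult_map_scale_conv_mult)
  then show ?thesis by (simp add: Poly_Mapping.map.rep_eq when_def)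
qed

lemma weight_le_gscale: "weight_le d f \<Longrightarrow> weight_le d (gscale c f)"
  by (auto simp: weight_le_def in_keys_iff lookup_gscale)

lemma weight_le_pdiff_var:
  assumes "weight_le d f"
  shows "weight_le (d - (2 * int i + 1)) (pdiff_var i f)"
  unfolding pdiff_var_def
proof (rule weight_le_sum)
  fix e assume e: "e \<in> Poly_Mapping.keys f"
  show "weight_le (d - (2 * int i + 1)) (Poly_Mapping.single (e - Poly_Mapping.single i 1)
       (of_nat (Poly_Mapping.lookup e i) * Poly_Mapping.lookup f e))"
  proof (cases "Poly_Mapping.lookup e i = 0")
    case False
    then have "weight e = weight (e - Poly_Mapping.single i 1) + (2 * i + 1)"
      by (intro weight_minus_single) auto
    moreover have "int (weight e) \<le> d" using e assms by (auto simp: weight_le_def)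
    ultimately show ?thesis by (intro weight_le_single) linarith
  qed simp
qed

lemma weight_le_annih:
  assumes "weight_le d f"
  shows "weight_le (d - int n) (Y_annih t n f)"
proof (cases "odd n")
  case True
  then have "2 * int (n div 2) + 1 = int n" by presburger
  then have "weight_le (d - int n) (pdiff_var (n div 2) f)"
    using weight_le_pdiff_var[OF assms, of "n div 2"] by simp
  then show ?thesis using True
    by (auto simp: Y_annih_def heis_def intro!: weight_le_gscale)
qed (simp add: Y_annih_def)

lemma weight_le_op_power_annih:
  "weight_le d f \<Longrightarrow> weight_le (d - int n) (op_power (Y_annih t) k n f)"
proof (induction k arbitrary: n)
  case (Suc k)
  have "weight_le (d - int n) (Y_annih t i (op_power (Y_annih t) k (n - i) f))"
    if "i \<in> {..n}" for i
  proof -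
    have "d - int (n - i) - int i = d - int n" using that by auto
    then show ?thesis
      using weight_le_annih[OF Suc.IH[OF Suc.prems, of "n - i"], of i t] by simp
  qed
  then show ?case by (auto intro!: weight_le_sum)
qed simp

lemma annih_eq_0:
  assumes "weight_le d f" "d < int j"
  shows "op_exp (Y_annih t) j f = 0"
proof -
  have "weight_le (d - int j) (op_exp (Y_annih t) j f)"
    unfolding op_exp_def
    by (intro weight_le_sum weight_le_gscale weight_le_op_power_annih assms)
  then have "Poly_Mapping.keys (op_exp (Y_annih t) j f) = {}"
    using assms(2) by (force simp: weight_le_def)
  then show ?thesis by simp
qed

lemma finite_annih: "finite {j. op_exp (Y_annih t) j f \<noteq> 0}"
proof -
  define d where "d = Max (insert 0 ((\<lambda>e. int (weight e)) ` Poly_Mapping.keys f))"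
  have "weight_le d f" by (auto simp: weight_le_def d_def)
  then have "{j. op_exp (Y_annih t) j f \<noteq> 0} \<subseteq> {..nat d}"
    using annih_eq_0[of d f _ t] by (force simp: not_less)
  then show ?thesis by (rule finite_subset) simp
qed

text \<open>The one-row functions are the coefficients of Y(z;t) applied to the unit element.\<close>

lemma op_power_create: "op_power (Y_create t) k n f = fps_nth (q_exponent t ^ k) n * f"
proof (induction k arbitrary: n)
  case (Suc k)
  have c: "Y_create t i g = fps_nth (q_exponent t) i * g" for i g
    by (auto simp: Y_create_def q_exponent_def heis_def gscale_def mult.assoc
        dest: odd_pos)
  show ?case
    unfolding op_power.simps Suc.IH
    by (simp only: c power_Suc fps_mult_nth sum_distrib_right mult.assoc atLeast0AtMost)
qed simp

lemma op_exp_create: "op_exp (Y_create t) n f = q_row t n * f"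
  by (simp add: op_exp_def op_power_create q_row_def gam_exp_def gscale_def sum_distrib_right
      mult.assoc)

lemma Y_mode_unit: "Y_mode t (- int r) 1 = q_row t r"
proof -
  have w: "weight_le 0 (1 :: 'a gam)"
    by (simp add: weight_le_def weight_def)
  have z: "op_exp (Y_annih t) 0 1 = 1"
    by (simp add: op_exp_def gscale_def)
  have "Y_mode t (- int r) 1 =
      Sum_any (\<lambda>j. q_row t (nat (int j + int r)) * op_exp (Y_annih t) j 1)"
    by (simp add: Y_mode_def op_exp_create)
  also have "\<dots> = (\<Sum>j\<in>{0}. q_row t (nat (int j + int r)) * op_exp (Y_annih t) j 1)"
    by (rule Sum_any.expand_superset) (use annih_eq_0[OF w, of _ t] in \<open>auto intro!: gr0I\<close>)
  finally show ?thesis by (simp add: z)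
qed

end

theory Submission
  imports Defs
begin

text \<open>
  The creation factor of Y(z;t) acts as multiplication by the generating series of the one-row
  functions. So only the action of the annihilation factor on Q(w;s) = Y(w;s)1 has to be computed.
  The operator a_n is (n/2) times the derivation d/dp_n, and Q(w;s) is the exponential of a
  series that is linear in the power sums. Hence Q(w;s) is an eigenvector: a_n multiplies it by
  (1 - s^n) w^n for odd n (lemmas \<open>pdiff_var_q_row\<close> and \<open>Y_annih_q_row\<close>). The exponential
  of the annihilation part therefore multiplies it by
  exp (- 2 sum (1 - s^n) / (1 - t^n) (w/z)^n / n), summed over odd n, which is
  sum f_k(t,s) (w/z)^k (lemma \<open>op_exp_annih_q_row\<close>). Comparing the coefficients of z^r w^m
  gives the expansion \<open>Q_mixed_expansion\<close>, over any field of characteristic zero.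

  For s = t the series F = sum f_k u^k is the exponential of -2 times the sum of u^n / n over
  odd n. Thus (1 - u^2) F' = -2 F, and together with f_0 = 1 this forces f_k = 2 (-1)^k for
  k > 0 (lemma \<open>f_coeff_equal\<close>); in closed form, F = (1 - u) / (1 + u).
\<close>

section \<open>Scalar multiplication\<close>

lemma gscale_0_left [simp]: "gscale 0 f = 0"
  by (simp add: gscale_def)

lemma gscale_0_right [simp]: "gscale c 0 = 0"
  by (simp add: gscale_def)

lemma gscale_1 [simp]: "gscale 1 f = f"
  by (simp add: gscale_def)

lemma gscale_gscale: "gscale c (gscale d f) = gscale (c * d) f"
  by (simp add: gscale_def mult_single flip: mult.assoc)

lemma gscale_add_left: "gscale (c + d) f = gscale c f + gscale d f"
  by (simp add: gscale_def single_add distrib_right)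

lemma gscale_sum_left: "gscale (sum c S) f = (\<Sum>x\<in>S. gscale (c x) f)"
  by (induction S rule: infinite_finite_induct) (auto simp: gscale_add_left)

lemma gscale_sum_right: "gscale c (sum f S) = (\<Sum>x\<in>S. gscale c (f x))"
  by (simp add: gscale_def sum_distrib_left)

lemma mult_gscale: "f * gscale c g = gscale c (f * g)"
  by (simp add: gscale_def mult_ac)

section \<open>Partial derivatives\<close>

lemma pdiff_var_single:
  "pdiff_var i (Poly_Mapping.single e c) =
     Poly_Mapping.single (e - Poly_Mapping.single i 1) (of_nat (Poly_Mapping.lookup e i) * c)"
  by (cases "c = 0") (simp_all add: pdiff_var_def)

lemma pdiff_var_superset:
  assumes "finite S" "Poly_Mapping.keys f \<subseteq> S"
  shows "pdiff_var i f = (\<Sum>e\<in>S. Poly_Mapping.single (e - Poly_Mapping.single i 1)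
           (of_nat (Poly_Mapping.lookup e i) * Poly_Mapping.lookup f e))"
  unfolding pdiff_var_def using assms
  by (intro sum.mono_neutral_left) (auto simp: in_keys_iff)

lemma pdiff_var_add: "pdiff_var i (f + g) = pdiff_var i f + pdiff_var i g"
proof -
  let ?S = "Poly_Mapping.keys f \<union> Poly_Mapping.keys g"
  have "finite ?S" "Poly_Mapping.keys (f + g) \<subseteq> ?S" by (simp_all add: keys_add)
  then show ?thesis
    by (simp add: pdiff_var_superset[of ?S] lookup_add algebra_simps single_add sum.distrib)
qed

lemma pdiff_var_0 [simp]: "pdiff_var i 0 = 0"
  by (simp add: pdiff_var_def)

lemma pdiff_var_sum: "pdiff_var i (sum f S) = (\<Sum>x\<in>S. pdiff_var i (f x))"
  by (induction S rule: infinite_finite_induct) (auto simp: pdiff_var_add)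

lemma poly_mapping_sum_single:
  "f = (\<Sum>e\<in>Poly_Mapping.keys f. Poly_Mapping.single e (Poly_Mapping.lookup f e))"
  by (rule poly_mapping_eqI) (simp add: lookup_sum lookup_single when_def in_keys_iff)

lemma pdiff_var_mult_single:
  "pdiff_var i (Poly_Mapping.single e c * Poly_Mapping.single e' c') =
     pdiff_var i (Poly_Mapping.single e c) * Poly_Mapping.single e' c' +
     Poly_Mapping.single e c * pdiff_var i (Poly_Mapping.single e' c')"
proof -
  let ?\<epsilon> = "Poly_Mapping.single i (1::nat)"
  \<comment> \<open>Where the subtraction of exponents is truncated, the coefficient is 0.\<close>
  have shift: "(a - ?\<epsilon>) + b = (a + b) - ?\<epsilon>" if "Poly_Mapping.lookup a i > 0" for a b
    using that by (intro poly_mapping_eqI) (auto simp: lookup_add lookup_minus lookup_single when_def)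
  have 1: "Poly_Mapping.single (e - ?\<epsilon> + e') (of_nat (Poly_Mapping.lookup e i) * c * c') =
      Poly_Mapping.single (e + e' - ?\<epsilon>) (of_nat (Poly_Mapping.lookup e i) * c * c')"
    using shift[of e e'] by (cases "Poly_Mapping.lookup e i = 0") simp_all
  have 2: "Poly_Mapping.single (e + (e' - ?\<epsilon>)) (c * (of_nat (Poly_Mapping.lookup e' i) * c')) =
      Poly_Mapping.single (e + e' - ?\<epsilon>) (c * (of_nat (Poly_Mapping.lookup e' i) * c'))"
    using shift[of e' e] by (cases "Poly_Mapping.lookup e' i = 0") (simp_all add: add.commute)
  show ?thesis
    unfolding pdiff_var_single mult_single 1 2
    by (simp add: lookup_add algebra_simps flip: single_add)
qed

lemma pdiff_var_mult: "pdiff_var i (f * g) = pdiff_var i f * g + f * pdiff_var i g"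
proof -
  let ?m = "\<lambda>f e. Poly_Mapping.single e (Poly_Mapping.lookup f e)"
  have "pdiff_var i ((\<Sum>e\<in>A. ?m f e) * (\<Sum>e\<in>B. ?m g e)) =
      pdiff_var i (\<Sum>e\<in>A. ?m f e) * (\<Sum>e\<in>B. ?m g e) +
      (\<Sum>e\<in>A. ?m f e) * pdiff_var i (\<Sum>e\<in>B. ?m g e)" for A B
    unfolding sum_product pdiff_var_sum pdiff_var_mult_single sum.distrib ..
  from this[of "Poly_Mapping.keys f" "Poly_Mapping.keys g"] show ?thesis
    unfolding poly_mapping_sum_single[symmetric] .
qed

lemma pdiff_var_gscale: "pdiff_var i (gscale c f) = gscale c (pdiff_var i f)"
  unfolding gscale_def pdiff_var_mult by (simp add: pdiff_var_single)

lemma pdiff_var_psum: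
  assumes "odd n"
  shows "pdiff_var i (psum n) = (if n = 2 * i + 1 then 1 else 0)"
  using assms by (auto simp: psum_def pdiff_var_single lookup_single when_def)

section \<open>Derivatives of exponential series\<close>

text \<open>The partial derivative of a power series over the polynomial ring, taken coefficientwise.\<close>

definition fps_pdiff :: "nat \<Rightarrow> 'k::field_char_0 gam fps \<Rightarrow> 'k gam fps" where
  "fps_pdiff i A = Abs_fps (\<lambda>n. pdiff_var i (fps_nth A n))"

lemma fps_pdiff_nth [simp]: "fps_nth (fps_pdiff i A) n = pdiff_var i (fps_nth A n)"
  by (simp add: fps_pdiff_def)

lemma fps_pdiff_mult: "fps_pdiff i (A * B) = fps_pdiff i A * B + A * fps_pdiff i B"
  by (rule fps_ext) (simp add: fps_mult_nth pdiff_var_sum pdiff_var_mult sum.distrib)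

lemma pdiff_var_1 [simp]: "pdiff_var i 1 = 0"
  using pdiff_var_single[of i 0 1] by simp

lemma fps_pdiff_power:
  "fps_nth (fps_pdiff i (A ^ Suc k)) n = gscale (of_nat (Suc k)) (fps_nth (fps_pdiff i A * A ^ k) n)"
proof (induction k arbitrary: n)
  case (Suc k)
  have "fps_nth (A * fps_pdiff i (A ^ Suc k)) n =
      gscale (of_nat (Suc k)) (fps_nth (A * (fps_pdiff i A * A ^ k)) n)"
    by (simp only: fps_mult_nth[of A] Suc mult_gscale gscale_sum_right)
  also have "A * (fps_pdiff i A * A ^ k) = fps_pdiff i A * A ^ Suc k"
    by (simp add: mult_ac)
  finally show ?case
    unfolding power_Suc[of A "Suc k"] fps_pdiff_mult fps_add_nth of_nat_Suc[of "Suc k"]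
    by (simp only: gscale_add_left gscale_1)
qed simp

text \<open>Because A has no constant term, the exponential series may be cut off at any later index.\<close>

lemma gam_exp_nth:
  assumes "fps_nth A 0 = 0" "n \<le> N"
  shows "fps_nth (gam_exp A) n = (\<Sum>k\<le>N. gscale (1 / fact k) (fps_nth (A ^ k) n))"
  unfolding gam_exp_def fps_nth_Abs_fps using assms
  by (intro sum.mono_neutral_left) (auto simp: startsby_zero_power_prefix)

lemma fps_pdiff_gam_exp:
  assumes "fps_nth A 0 = 0"
  shows "fps_pdiff i (gam_exp A) = fps_pdiff i A * gam_exp A"
proof (rule fps_ext)
  fix n
  have "fps_nth (fps_pdiff i (gam_exp A)) n =
      (\<Sum>k\<le>Suc n. gscale (1 / fact k) (fps_nth (fps_pdiff i (A ^ k)) n))"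
    by (simp only: fps_pdiff_nth gam_exp_nth[OF assms, of n "Suc n"] pdiff_var_sum
        pdiff_var_gscale le_SucI)
  \<comment> \<open>The sum above runs to n + 1 because differentiation lowers the exponent k by one.\<close>
  also have "\<dots> = (\<Sum>k\<le>n. gscale (1 / fact (Suc k)) (fps_nth (fps_pdiff i (A ^ Suc k)) n))"
    by (subst sum.atMost_Suc_shift) (simp add: fps_one_nth)
  also have "\<dots> = (\<Sum>k\<le>n. gscale (1 / fact k) (fps_nth (fps_pdiff i A * A ^ k) n))"
    unfolding fps_pdiff_power gscale_gscale
    by (intro sum.cong) (auto simp: fact_Suc simp del: of_nat_Suc)
  also have "\<dots> = (\<Sum>j=0..n. \<Sum>k\<le>n.
      fps_nth (fps_pdiff i A) j * gscale (1 / fact k) (fps_nth (A ^ k) (n - j)))"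
    unfolding fps_mult_nth gscale_sum_right by (subst sum.swap) (simp only: mult_gscale)
  also have "\<dots> = fps_nth (fps_pdiff i A * gam_exp A) n"
    unfolding fps_mult_nth sum_distrib_left[symmetric]
    by (intro sum.cong refl arg_cong2[where f = "(*)"] gam_exp_nth[OF assms, symmetric]) auto
  finally show "fps_nth (fps_pdiff i (gam_exp A)) n = fps_nth (fps_pdiff i A * gam_exp A) n" .
qed

lemma pdiff_var_q_row:
  "pdiff_var i (q_row s m) = (if 2 * i + 1 \<le> m
     then gscale (2 * (1 - s ^ (2 * i + 1)) / of_nat (2 * i + 1)) (q_row s (m - (2 * i + 1))) else 0)"
proof -
  define c where "c = gscale (2 * (1 - s ^ (2 * i + 1)) / of_nat (2 * i + 1)) 1"
  have z: "fps_nth (q_exponent s) 0 = 0" by (simp add: q_exponent_def)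
  have d: "fps_nth (fps_pdiff i (q_exponent s)) n = (if n = 2 * i + 1 then c else 0)" for n
    by (auto simp: q_exponent_def pdiff_var_gscale pdiff_var_psum c_def)
  have "pdiff_var i (q_row s m) = fps_nth (fps_pdiff i (q_exponent s) * gam_exp (q_exponent s)) m"
    by (simp add: q_row_def flip: fps_pdiff_gam_exp[OF z])
  also have "\<dots> = (\<Sum>j=0..m. if j = 2 * i + 1 then c * q_row s (m - j) else 0)"
    unfolding fps_mult_nth d q_row_def by (intro sum.cong) auto
  also have "\<dots> = (if 2 * i + 1 \<le> m then c * q_row s (m - (2 * i + 1)) else 0)"
    by (subst sum.delta) auto
  finally show ?thesis by (simp add: c_def gscale_def)
qed

section \<open>The annihilation part on one-row functions\<close>

text \<open>
  The series in u whose exponential generates the expansion coefficients. Where t^n = 1 the quotient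
  is 0 by convention, and \<open>Y_annih\<close> has the same default, so the expansion of
  \<open>Q_mixed\<close> needs no assumption on t.
\<close>

definition f_exponent :: "'k::field_char_0 \<Rightarrow> 'k \<Rightarrow> 'k fps" where
  "f_exponent t s =
     Abs_fps (\<lambda>n. if odd n then - 2 * ((1 - s ^ n) / (1 - t ^ n)) / of_nat n else 0)"

text \<open>
  The coefficient form of the eigenvector property: with Q(w;s) the generating series of the
  one-row functions, the term of degree n of the annihilation exponent maps Q(w;s) to w^n Q(w;s)
  times the coefficient of u^n in \<open>f_exponent\<close>.
\<close>

lemma Y_annih_q_row:
  "Y_annih t n (q_row s m) =
     gscale (fps_nth (f_exponent t s) n) (if n \<le> m then q_row s (m - n) else 0)"
proof (cases "odd n")
  case True
  then have n: "2 * (n div 2) + 1 = n" by presburger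
  have "n > 0" using True by (rule odd_pos)
  have "- 2 * (a / b) / c = - (2 / (c * b)) * a" for a b c :: 'a
    by simp
  then have "fps_nth (f_exponent t s) n = - (2 / (of_nat n * (1 - t ^ n))) * (1 - s ^ n)"
    unfolding f_exponent_def fps_nth_Abs_fps using True by presburger
  also have "1 - s ^ n = of_nat n / 2 * (2 * (1 - s ^ n) / of_nat n)"
    using \<open>n > 0\<close> by simp
  finally have c: "fps_nth (f_exponent t s) n =
      - (2 / (of_nat n * (1 - t ^ n))) * (of_nat n / 2 * (2 * (1 - s ^ n) / of_nat n))" .
  have "Y_annih t n (q_row s m) = gscale (- (2 / (of_nat n * (1 - t ^ n))))
      (gscale (of_nat n / 2) (pdiff_var (n div 2) (q_row s m)))"
    using True by (simp add: Y_annih_def heis_def)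
  also have "\<dots> = gscale (fps_nth (f_exponent t s) n) (if n \<le> m then q_row s (m - n) else 0)"
    unfolding pdiff_var_q_row[of "n div 2" s m, unfolded n] c
    by (cases "n \<le> m") (simp_all only: if_True if_False gscale_gscale gscale_0_right mult.assoc)
  finally show ?thesis .
qed (simp add: Y_annih_def f_exponent_def)

lemma Y_annih_0 [simp]: "Y_annih t n 0 = 0"
  by (simp add: Y_annih_def heis_def)

lemma Y_annih_gscale: "Y_annih t n (gscale c f) = gscale c (Y_annih t n f)"
  by (simp add: Y_annih_def heis_def gscale_gscale pdiff_var_gscale mult_ac)

lemma op_power_annih_q_row:
  "op_power (Y_annih t) k n (q_row s m) =
     gscale (fps_nth (f_exponent t s ^ k) n) (if n \<le> m then q_row s (m - n) else 0)"
proof (induction k arbitrary: n)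
  case (Suc k)
  have "Y_annih t i (op_power (Y_annih t) k (n - i) (q_row s m)) =
      gscale (fps_nth (f_exponent t s) i * fps_nth (f_exponent t s ^ k) (n - i))
        (if n \<le> m then q_row s (m - n) else 0)" if "i \<le> n" for i
    using that by (auto simp: Suc Y_annih_gscale Y_annih_q_row gscale_gscale mult_ac)
  then show ?case
    by (simp add: fps_mult_nth gscale_sum_left atLeast0AtMost)
qed (auto simp: fps_one_nth)

lemma op_exp_annih_q_row:
  "op_exp (Y_annih t) n (q_row s m) =
     gscale (f_coeff t s n) (if n \<le> m then q_row s (m - n) else 0)"
proof -
  have "f_coeff t s n = (\<Sum>k\<le>n. 1 / fact k * fps_nth (f_exponent t s ^ k) n)"
    by (simp add: f_coeff_def f_exponent_def fps_compose_nth atLeast0AtMost)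
  then show ?thesis
    by (simp add: op_exp_def op_power_annih_q_row gscale_gscale gscale_sum_left)
qed

lemma Q_mixed_expansion:
  "Q_mixed t s r m = (\<Sum>k=0..m. gscale (f_coeff t s k) (q_row t (r + k) * q_row s (m - k)))"
proof -
  have "Q_mixed t s r m =
      Sum_any (\<lambda>j. q_row t (nat (int j + int r)) * op_exp (Y_annih t) j (q_row s m))"
    by (simp add: Q_mixed_def Y_mode_unit) (simp add: Y_mode_def op_exp_create)
  also have "\<dots> = (\<Sum>j\<in>{0..m}. q_row t (nat (int j + int r)) * op_exp (Y_annih t) j (q_row s m))"
    by (rule Sum_any.expand_superset) (auto simp: op_exp_annih_q_row split: if_splits)
  also have "\<dots> = (\<Sum>k=0..m. gscale (f_coeff t s k) (q_row t (r + k) * q_row s (m - k)))"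
  proof (rule sum.cong)
    fix k
    have "nat (int k + int r) = r + k" by simp
    then show "q_row t (nat (int k + int r)) * op_exp (Y_annih t) k (q_row s m) =
        gscale (f_coeff t s k) (q_row t (r + k) * q_row s (m - k))" if "k \<in> {0..m}"
      using that by (simp add: op_exp_annih_q_row mult_gscale)
  qed simp
  finally show ?thesis .
qed

section \<open>Equal parameters\<close>

lemma f_coeff_equal:
  assumes "\<And>n. odd n \<Longrightarrow> t ^ n \<noteq> 1"
  shows "f_coeff t t k = (if k = 0 then 1 else 2 * (- 1) ^ k)"
proof -
  define G where "G = f_exponent t t"
  define F where "F = fps_exp 1 oo G"
  have f: "f_coeff t t k = fps_nth F k" for k
    by (simp add: f_coeff_def F_def G_def f_exponent_def)
  have G: "fps_nth G n = (if odd n then - 2 / of_nat n else 0)" for n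
    using assms[of n] by (simp add: G_def f_exponent_def)
  have F0: "fps_nth F 0 = 1" by (simp add: F_def)
  have dG: "(1 - fps_X ^ 2) * fps_deriv G = fps_const (- 2)"
  proof (rule fps_ext)
    fix n
    have c: "fps_nth (fps_deriv G) j = (if even j then - 2 else 0)" for j
      using of_nat_neq_0[of j, where 'a = 'a] by (simp add: G del: of_nat_Suc)
    show "fps_nth ((1 - fps_X ^ 2) * fps_deriv G) n = fps_nth (fps_const (- 2)) n"
      unfolding left_diff_distrib fps_sub_nth fps_X_power_mult_nth mult_1 c
      by (cases "n < 2") (auto simp: less_2_cases_iff)
  qed
  have "fps_deriv F = F * fps_deriv G"
    unfolding F_def by (subst fps_compose_deriv) (simp_all add: G)
  then have "(1 - fps_X ^ 2) * fps_deriv F = F * ((1 - fps_X ^ 2) * fps_deriv G)"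
    by (simp add: mult_ac)
  then have ode: "fps_nth ((1 - fps_X ^ 2) * fps_deriv F) n = - 2 * fps_nth F n" for n
    unfolding dG by simp
  \<comment> \<open>For n < 2 the truncated factor n - 1 is 0, so no boundary case is needed.\<close>
  have rec: "of_nat (Suc n) * fps_nth F (Suc n) =
      of_nat (n - 1) * fps_nth F (n - 1) - 2 * fps_nth F n" for n
  proof -
    have "fps_nth (fps_deriv F) n - (if n < 2 then 0 else fps_nth (fps_deriv F) (n - 2)) =
        - 2 * fps_nth F n"
      using ode[of n]
      by (simp only: left_diff_distrib fps_sub_nth fps_X_power_mult_nth mult_1)
    then have "fps_nth (fps_deriv F) n =
        (if n < 2 then 0 else fps_nth (fps_deriv F) (n - 2)) - 2 * fps_nth F n"
      by (simp add: diff_eq_eq del: fps_deriv_nth)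
    moreover have "Suc (n - 2) = n - 1" if "\<not> n < 2"
      using that by simp
    ultimately show ?thesis
      by (cases "n < 2") (auto simp: less_2_cases_iff simp del: of_nat_Suc)
  qed
  have "fps_nth F k = (if k = 0 then 1 else 2 * (- 1) ^ k)"
  proof (induction k rule: less_induct)
    case (less k)
    consider "k = 0" | "k = 1" | "k = 2" | n where "k = Suc (Suc (Suc n))"
      by (metis One_nat_def Suc_1 not0_implies_Suc)
    then show ?case
    proof cases
      case 2
      then show ?thesis using rec[of 0] F0 by simp
    next
      case 3
      then show ?thesis using rec[of 1] less[of 1] by (simp add: numeral_2_eq_2)
    next
      case (4 n)
      have "of_nat k * fps_nth F k = of_nat k * (2 * (- 1) ^ k)"
        using rec[of "Suc (Suc n)"] less[of "Suc n"] less[of "Suc (Suc n)"] 4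
        by (simp add: algebra_simps)
      then have "fps_nth F k = 2 * (- 1) ^ k"
        using 4 of_nat_neq_0[of "Suc (Suc n)", where 'a = 'a]
        by (simp only: mult_cancel_left simp_thms)
      then show ?thesis using 4 by simp
    qed (simp add: F0)
  qed
  then show ?thesis by (simp add: f)
qed

lemma t_var1_power_neq_1:
  assumes "n > 0"
  shows "t_var1 ^ n \<noteq> 1"
proof
  assume "t_var1 ^ n = 1"
  moreover have "t_var1 ^ n = Fract ([:0, 1:] ^ n) 1"
    by (induction n) (simp_all add: t_var1_def One_fract_def)
  ultimately have "[:0, 1:] ^ n = (1 :: rat poly)"
    by (simp add: One_fract_def eq_fract)
  then have "poly ([:0, 1:] ^ n) 0 = poly (1 :: rat poly) 0"
    by simp
  then show False using assms by (simp add: poly_power zero_power)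
qed

theorem proposition3p5:
  shows "(\<forall>r m :: nat. Q_mixed t_var s_var r m =
            (\<Sum>k=0..m. gscale (f_coeff t_var s_var k)
               (q_row t_var (r + k) * q_row s_var (m - k))))
       \<and> (\<forall>r m :: nat. Q_mixed t_var1 t_var1 r m =
            q_row t_var1 r * q_row t_var1 m
            + 2 * (\<Sum>k=1..m. (- 1) ^ k * (q_row t_var1 (r + k) * q_row t_var1 (m - k))))"
proof (intro conjI allI)
  fix r m
  let ?q = "q_row t_var1"
  have f: "f_coeff t_var1 t_var1 k = (if k = 0 then 1 else 2 * (- 1) ^ k)" for k
    by (rule f_coeff_equal) (simp add: t_var1_power_neq_1 odd_pos)
  have scale: "gscale (2 * (- 1) ^ k) g = 2 * ((- 1) ^ k * g)" for k and g :: "rat_t gam"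
  proof -
    have "gscale 2 h = 2 * h" for h :: "rat_t gam"
      using gscale_add_left[of 1 1 h] by simp
    moreover have "gscale ((- 1) ^ k) g = (- 1) ^ k * g"
      by (cases "even k") (simp_all add: gscale_def single_uminus)
    ultimately show ?thesis by (simp flip: gscale_gscale)
  qed
  have "Q_mixed t_var1 t_var1 r m = gscale 1 (?q r * ?q m) +
      (\<Sum>k=1..m. gscale (f_coeff t_var1 t_var1 k) (?q (r + k) * ?q (m - k)))"
    unfolding Q_mixed_expansion by (subst sum.atLeast_Suc_atMost) (simp_all add: f)
  also have "(\<Sum>k=1..m. gscale (f_coeff t_var1 t_var1 k) (?q (r + k) * ?q (m - k))) =
      (\<Sum>k=1..m. 2 * ((- 1) ^ k * (?q (r + k) * ?q (m - k))))"
    by (intro sum.cong) (simp_all add: f scale)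
  finally show "Q_mixed t_var1 t_var1 r m =
      ?q r * ?q m + 2 * (\<Sum>k=1..m. (- 1) ^ k * (?q (r + k) * ?q (m - k)))"
    by (simp add: sum_distrib_left)
qed (rule Q_mixed_expansion)

end
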